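(* Let $r\ge1$, let $\mathcal{L}$ be a homogeneous Lagrangian on $\mathrm{Imm}\,T^r_nX$, and let $(V,\psi)$, $(\bar V,\bar\psi)$ be two overlapping charts on $X$. Let $L$ and $\bar L$ be the non-homogeneous Lagrangians associated to $\mathcal{L}$ in the associated charts on $W^r$ and $\bar W^r$. Then on the overlap $\rho^r_n(W^r\cap\bar W^r)$ $$L=\mathcal{J}\,\bar L,\qquad\mathcal{J}=\det(Q)=\det(D_i\bar x^j).$$
   Context: $X$ is a smooth manifold of dimension $N=n+m$, $n\ge 1$. $T^r_nX$ is the manifold of $(r,n)$-velocities, i.e. $r$-jets $j^r_0\gamma$ at $0$ of smooth maps $\gamma$ from a neighbourhood of $0\in\mathbb{R}^n$ to $X$; $\mathrm{Imm}\,T^r_nX$ is the open subset of regular velocities (jets of immersions). A chart $(V,(x^A))$ of $X$ induces coordinates $x^A_{j_1,\dots,j_k}(j^r_0\gamma)=\partial^k(x^A\circ\gamma)/\partial t^{j_1}\cdots\partial t^{j_k}|_0$, $0\le k\le r$, symmetric in the lower indices. $L^r_n$ is the group of $r$-jets at $0$ of local diffeomorphisms of $\mathbb{R}^n$ fixing $0$; it acts on the right on $T^r_nX$ by $j^r_0\gamma\cdot j^r_0\alpha=j^r_0(\gamma\circ\alpha)$; for $a=j^r_0\alpha$, $\det(a)$ is the Jacobian determinant of $\alpha$ at $0$. $P^r_nX=\mathrm{Imm}\,T^r_nX/L^r_n$, with projection $\rho^r_n$ (a smooth principal bundle). Split the coordinates of a chart of $X$ (in any way) into $x^i$ ($i=1,\dots,n$)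 and $x^\sigma$ ($\sigma=1,\dots,m$). $W^r$ is the set of regular velocities over $V$ with $\det(\mathbf{x}):=\det(x^i_j)\ne0$; there $(z^i_j)$ is the inverse matrix of $(x^i_j)$ and $y^\sigma=x^\sigma$, $y^\sigma_{i_1,\dots,i_k}=z^j_{i_1}d_jy^\sigma_{i_2,\dots,i_k}$, where $d_j$ is the formal (total) derivative, $d_jx^A_J=x^A_{jJ}$. The $y^\sigma_I$ are symmetric in $I$ and $L^r_n$-invariant, and $(x^i,y^\sigma_I)_{|I|\le r}$ are coordinates on $\rho^r_n(W^r)$. On functions of $(x^i,y^\sigma)$, $D_i=\frac{\partial}{\partial x^i}+y^\sigma_i\frac{\partial}{\partial y^\sigma}$. Objects of the second chart (with its own splitting) are barred. Homogeneous Lagrangian: a smooth real function $\mathcal{L}$ on $\mathrm{Imm}\,T^r_nX$ with $\mathcal{L}(x\cdot a)=\det(a)\mathcal{L}(x)$ for all $a\in L^r_n$; the associated non-homogeneous Lagrangian in a chart is the smooth function $L$ on $\rho^r_n(W^r)$ with $\mathcal{L}=\det(\mathbf{x})\,L\circ\rho^r_n$ on $W^r$. $Q^j_i=D_i\bar x^j$. *)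

theory Defs
  imports "HOL-Analysis.Analysis" "HOL-Library.Multiset"
begin

section \<open>Smooth maps between Euclidean spaces\<close>

definition partial_deriv ::
  "'n \<Rightarrow> (real^'n::finite \<Rightarrow> 'b::real_normed_vector) \<Rightarrow> real^'n \<Rightarrow> 'b" where
  "partial_deriv j f t = vector_derivative (\<lambda>h. f (t + h *\<^sub>R axis j 1)) (at 0)"

text \<open>\<open>partial_derivs [j\<^sub>1, \<dots>, j\<^sub>k] f\<close> is \<open>\<partial>\<^sup>k f / \<partial>t\<^sup>j\<^sup>1 \<dots> \<partial>t\<^sup>j\<^sup>k\<close>.\<close>

abbreviation partial_derivs ::
  "'n list \<Rightarrow> (real^'n::finite \<Rightarrow> 'b::real_normed_vector) \<Rightarrow> real^'n \<Rightarrow> 'b" where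
  "partial_derivs js f \<equiv> foldr partial_deriv js f"

text \<open>On an open set, total differentiability of all iterated partial derivatives is the same
  as existence and continuity of all of them.\<close>

definition smooth_on :: "(real^'n::finite) set \<Rightarrow> (real^'n \<Rightarrow> real^'k::finite) \<Rightarrow> bool" where
  "smooth_on U f \<longleftrightarrow> open U \<and> (\<forall>js. partial_derivs js f differentiable_on U)"

section \<open>Smooth manifolds\<close>

text \<open>A chart is a pair \<open>(V, \<psi>)\<close>; the values of \<open>\<psi>\<close> outside \<open>V\<close> are irrelevant.
  The underlying space of a manifold is a whole type, whose sort supplies the
  Hausdorff property and second countability.\<close>

type_synonym ('x, 'N) chart = "'x set \<times> ('x \<Rightarrow> real^'N)"

definition is_chart :: "('x::topological_space, 'N::finite) chart \<Rightarrow> bool" where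
  "is_chart = (\<lambda>(V, \<psi>). open V \<and> open (\<psi> ` V) \<and> homeomorphism V (\<psi> ` V) \<psi> (inv_into V \<psi>))"

definition transition :: "('x, 'N::finite) chart \<Rightarrow> ('x, 'N) chart \<Rightarrow> real^'N \<Rightarrow> real^'N" where
  "transition c d = snd d \<circ> inv_into (fst c) (snd c)"

definition compatible :: "('x, 'N::finite) chart \<Rightarrow> ('x, 'N) chart \<Rightarrow> bool" where
  "compatible c d \<longleftrightarrow>
     smooth_on (snd c ` (fst c \<inter> fst d)) (transition c d) \<and>
     smooth_on (snd d ` (fst c \<inter> fst d)) (transition d c)"

text \<open>A smooth structure is a maximal smooth atlas.\<close>

definition smooth_structure ::
  "('x::{t2_space, second_countable_topology}, 'N::finite) chart set \<Rightarrow> bool" where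
  "smooth_structure \<A> \<longleftrightarrow>
     (\<forall>c\<in>\<A>. is_chart c) \<and> (\<Union>c\<in>\<A>. fst c) = UNIV \<and>
     (\<forall>c\<in>\<A>. \<forall>d\<in>\<A>. compatible c d) \<and>
     (\<forall>c. is_chart c \<and> (\<forall>d\<in>\<A>. compatible c d) \<longrightarrow> c \<in> \<A>)"

definition manifold_smooth_on :: "('x::topological_space, 'N::finite) chart set \<Rightarrow>
    (real^'n::finite) set \<Rightarrow> (real^'n \<Rightarrow> 'x) \<Rightarrow> bool" where
  "manifold_smooth_on \<A> U \<gamma> \<longleftrightarrow> open U \<and> continuous_on U \<gamma> \<and>
     (\<forall>(V, \<psi>)\<in>\<A>. smooth_on (U \<inter> \<gamma> -` V) (\<psi> \<circ> \<gamma>))"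

definition immersion_on :: "('x::topological_space, 'N::finite) chart set \<Rightarrow>
    (real^'n::finite) set \<Rightarrow> (real^'n \<Rightarrow> 'x) \<Rightarrow> bool" where
  "immersion_on \<A> U \<gamma> \<longleftrightarrow> manifold_smooth_on \<A> U \<gamma> \<and>
     (\<forall>t\<in>U. \<forall>(V, \<psi>)\<in>\<A>. \<gamma> t \<in> V \<longrightarrow> inj (frechet_derivative (\<psi> \<circ> \<gamma>) (at t)))"

section \<open>Jets and velocities\<close>

text \<open>The \<open>r\<close>-jet at \<open>0\<close> is the equivalence class, among maps smooth near \<open>0\<close>, of having the
  same value and the same partial derivatives up to order \<open>r\<close> at \<open>0\<close>. Maps are total functions,
  but their values away from \<open>0\<close> play no role.\<close>

definition jet :: "('x::topological_space, 'N::finite) chart set \<Rightarrow> nat \<Rightarrow>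
    (real^'n::finite \<Rightarrow> 'x) \<Rightarrow> (real^'n \<Rightarrow> 'x) set" where
  "jet \<A> r \<gamma> = {\<delta>. (\<exists>U. 0 \<in> U \<and> manifold_smooth_on \<A> U \<delta>) \<and> \<delta> 0 = \<gamma> 0 \<and>
     (\<forall>(V, \<psi>)\<in>\<A>. \<gamma> 0 \<in> V \<longrightarrow>
        (\<forall>js. length js \<le> r \<longrightarrow> partial_derivs js (\<psi> \<circ> \<delta>) 0 = partial_derivs js (\<psi> \<circ> \<gamma>) 0))}"

definition rep :: "'a set \<Rightarrow> 'a" where
  "rep S = (SOME x. x \<in> S)"

definition regular_velocities ::
  "('x::topological_space, 'N::finite) chart set \<Rightarrow> nat \<Rightarrow> (real^'n::finite \<Rightarrow> 'x) set set" where
  "regular_velocities \<A> r = {jet \<A> r \<gamma> | \<gamma>. \<exists>U. 0 \<in> U \<and> immersion_on \<A> U \<gamma>}"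

text \<open>The one-chart atlas \<open>std_atlas\<close> is not maximal, but it determines the same jets as the
  standard smooth structure of Euclidean space.\<close>

definition std_atlas :: "(real^'n::finite, 'n) chart set" where
  "std_atlas = {(UNIV, id)}"

definition local_diffeo_fixing_0 :: "(real^'n::finite \<Rightarrow> real^'n) \<Rightarrow> bool" where
  "local_diffeo_fixing_0 \<alpha> \<longleftrightarrow> \<alpha> 0 = 0 \<and>
     (\<exists>U U' \<beta>. 0 \<in> U \<and> smooth_on U \<alpha> \<and> smooth_on U' \<beta> \<and> homeomorphism U U' \<alpha> \<beta>)"

definition jet_group :: "nat \<Rightarrow> (real^'n::finite \<Rightarrow> real^'n) set set" where
  "jet_group r = {jet std_atlas r \<alpha> | \<alpha>. local_diffeo_fixing_0 \<alpha>}"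

definition jet_det :: "(real^'n::finite \<Rightarrow> real^'n) set \<Rightarrow> real" where
  "jet_det a = det (jacobian (rep a) (at 0))"

definition jet_act :: "('x::topological_space, 'N::finite) chart set \<Rightarrow> nat \<Rightarrow>
    (real^'n::finite \<Rightarrow> 'x) set \<Rightarrow> (real^'n \<Rightarrow> real^'n) set \<Rightarrow> (real^'n \<Rightarrow> 'x) set" where
  "jet_act \<A> r x a = jet \<A> r (rep x \<circ> rep a)"

text \<open>The projection onto the quotient by the jet group; points of the quotient are orbits.\<close>

definition orbit :: "('x::topological_space, 'N::finite) chart set \<Rightarrow> nat \<Rightarrow>
    (real^'n::finite \<Rightarrow> 'x) set \<Rightarrow> (real^'n \<Rightarrow> 'x) set set" where
  "orbit \<A> r x = {jet_act \<A> r x a | a. a \<in> jet_group r}"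

section \<open>Functions of finitely many coordinates\<close>

text \<open>The number of jet coordinates depends on \<open>r\<close>, so coordinate tuples are functions on an index
  type which vanish outside a finite index set \<open>K\<close>. With the product topology these form
  a copy of \<open>\<real>\<^sup>K\<close>.\<close>

definition coord_deriv :: "'k \<Rightarrow> (('k \<Rightarrow> real) \<Rightarrow> real) \<Rightarrow> ('k \<Rightarrow> real) \<Rightarrow> real" where
  "coord_deriv k f u = deriv (\<lambda>t. f (u(k := t))) (u k)"

text \<open>Smoothness on a set \<open>S\<close> that is open in the copy of \<open>\<real>\<^sup>K\<close>: all iterated partial
  derivatives along the coordinates in \<open>K\<close> exist and are continuous.\<close>

definition coord_smooth_on :: "'k set \<Rightarrow> ('k \<Rightarrow> real) set \<Rightarrow> (('k \<Rightarrow> real) \<Rightarrow> real) \<Rightarrow> bool" where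
  "coord_smooth_on K S f \<longleftrightarrow>
     (\<forall>ks\<in>lists K. continuous_on S (foldr coord_deriv ks f) \<and>
        (\<forall>u\<in>S. \<forall>k\<in>K. (\<lambda>t. foldr coord_deriv ks f (u(k := t))) field_differentiable at (u k)))"

section \<open>Coordinates on velocities\<close>

text \<open>The coordinate \<open>x\<^sup>A\<^sub>J\<close> is symmetric in its lower indices, so \<open>J\<close> is a multiset
  over the index type \<open>'n\<close>.\<close>

type_synonym ('N, 'n) jet_index = "'N \<times> 'n multiset"

definition velocity_indices :: "nat \<Rightarrow> ('N, 'n) jet_index set" where
  "velocity_indices r = {(A, J). size J \<le> r}"

definition enum_mset :: "'n multiset \<Rightarrow> 'n list" where
  "enum_mset J = (SOME js. mset js = J)"

definition velocity_coords :: "nat \<Rightarrow> ('x, 'N::finite) chart \<Rightarrow>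
    (real^'n::finite \<Rightarrow> 'x) set \<Rightarrow> ('N, 'n) jet_index \<Rightarrow> real" where
  "velocity_coords r c x = (\<lambda>(A, J). if (A, J) \<in> velocity_indices r
     then partial_derivs (enum_mset J) (snd c \<circ> rep x) 0 $ A else 0)"

definition velocities_over :: "('x::topological_space, 'N::finite) chart set \<Rightarrow> nat \<Rightarrow>
    ('x, 'N) chart \<Rightarrow> (real^'n::finite \<Rightarrow> 'x) set set" where
  "velocities_over \<A> r c = {x \<in> regular_velocities \<A> r. rep x 0 \<in> fst c}"

definition velocity_smooth :: "('x::topological_space, 'N::finite) chart set \<Rightarrow> nat \<Rightarrow>
    ((real^'n::finite \<Rightarrow> 'x) set \<Rightarrow> real) \<Rightarrow> bool" where
  "velocity_smooth \<A> r F \<longleftrightarrow> (\<forall>c\<in>\<A>. \<exists>f.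
     coord_smooth_on (velocity_indices r) (velocity_coords r c ` velocities_over \<A> r c) f \<and>
     (\<forall>x\<in>velocities_over \<A> r c. F x = f (velocity_coords r c x)))"

text \<open>A splitting of the coordinates of a chart into \<open>x\<^sup>i\<close> and \<open>x\<^sup>\<sigma>\<close> is an injection \<open>\<iota>\<close> of \<open>'n\<close>
  into \<open>'N\<close>: the \<open>x\<^sup>i\<close> are the coordinates \<open>x\<^sup>A\<close> with \<open>A = \<iota> i\<close>, and \<open>\<sigma>\<close> ranges over the complement
  of \<open>range \<iota>\<close>. So \<open>m = CARD('N) - CARD('n)\<close>, and \<open>m = 0\<close> is possible.\<close>

definition x_matrix :: "('n::finite \<Rightarrow> 'N) \<Rightarrow> (('N, 'n) jet_index \<Rightarrow> real) \<Rightarrow> real^'n^'n" where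
  "x_matrix \<iota> u = (\<chi> i j. u (\<iota> i, {#j#}))"

definition W :: "('x::topological_space, 'N::finite) chart set \<Rightarrow> nat \<Rightarrow> ('x, 'N) chart \<Rightarrow>
    ('n::finite \<Rightarrow> 'N) \<Rightarrow> (real^'n \<Rightarrow> 'x) set set" where
  "W \<A> r c \<iota> = {x \<in> velocities_over \<A> r c. det (x_matrix \<iota> (velocity_coords r c x)) \<noteq> 0}"

section \<open>Coordinates on the quotient\<close>

text \<open>The formal derivative \<open>d\<^sub>j\<close> applied to a function \<open>F\<close> of the coordinates of order at most \<open>k\<close>;
  it is the derivation sending \<open>x\<^sup>A\<^sub>J\<close> to \<open>x\<^sup>A\<^sub>j\<^sub>J\<close>.\<close>

definition formal_deriv :: "nat \<Rightarrow> 'n::finite \<Rightarrow> ((('N::finite, 'n) jet_index \<Rightarrow> real) \<Rightarrow> real) \<Rightarrow>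
    (('N, 'n) jet_index \<Rightarrow> real) \<Rightarrow> real" where
  "formal_deriv k j F u =
     (\<Sum>(A, J)\<in>velocity_indices k. u (A, add_mset j J) * coord_deriv (A, J) F u)"

text \<open>\<open>y_fun \<iota> \<sigma> [i\<^sub>1, \<dots>, i\<^sub>k]\<close> is \<open>y\<^sup>\<sigma>\<close> with lower indices \<open>i\<^sub>1, \<dots>, i\<^sub>k\<close>, as a function of
  the velocity coordinates.\<close>

fun y_fun :: "('n::finite \<Rightarrow> 'N::finite) \<Rightarrow> 'N \<Rightarrow> 'n list \<Rightarrow>
    (('N, 'n) jet_index \<Rightarrow> real) \<Rightarrow> real" where
  "y_fun \<iota> \<sigma> [] = (\<lambda>u. u (\<sigma>, {#}))"
| "y_fun \<iota> \<sigma> (i # is) = (\<lambda>u. \<Sum>j\<in>UNIV.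
     matrix_inv (x_matrix \<iota> u) $ j $ i * formal_deriv (length is) j (y_fun \<iota> \<sigma> is) u)"

text \<open>The coordinates on \<open>\<rho>(W)\<close>: the value at \<open>(\<iota> i, {#})\<close> is \<open>x\<^sup>i\<close>, the value at \<open>(\<sigma>, I)\<close>
  with \<open>\<sigma>\<close> outside \<open>range \<iota>\<close> is \<open>y\<^sup>\<sigma>\<^sub>I\<close>. By symmetry in \<open>I\<close> and invariance under the
  jet group neither the enumeration of \<open>I\<close> nor the representative of the orbit matters.\<close>

definition quotient_indices :: "('n \<Rightarrow> 'N) \<Rightarrow> nat \<Rightarrow> ('N, 'n) jet_index set" where
  "quotient_indices \<iota> r = {(A, I). size I \<le> r \<and> (A \<in> range \<iota> \<longrightarrow> I = {#})}"

definition quotient_coords :: "nat \<Rightarrow> ('x, 'N::finite) chart \<Rightarrow> ('n::finite \<Rightarrow> 'N) \<Rightarrow>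
    (real^'n \<Rightarrow> 'x) set set \<Rightarrow> ('N, 'n) jet_index \<Rightarrow> real" where
  "quotient_coords r c \<iota> p = (\<lambda>(A, I). if (A, I) \<in> quotient_indices \<iota> r
     then y_fun \<iota> A (enum_mset I) (velocity_coords r c (rep p)) else 0)"

text \<open>\<open>D\<^sub>i\<close> of a function \<open>f\<close> of \<open>(x\<^sup>i, y\<^sup>\<sigma>)\<close>, as a function of the coordinates on \<open>\<rho>(W)\<close>.\<close>

definition D :: "('n::finite \<Rightarrow> 'N::finite) \<Rightarrow> 'n \<Rightarrow> (real^'N \<Rightarrow> real) \<Rightarrow>
    (('N, 'n) jet_index \<Rightarrow> real) \<Rightarrow> real" where
  "D \<iota> i f w = (let q = (\<chi> A. w (A, {#})) in
     partial_deriv (\<iota> i) f q + (\<Sum>\<sigma>\<in>- range \<iota>. w (\<sigma>, {#i#}) * partial_deriv \<sigma> f q))"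

text \<open>The matrix \<open>Q\<^sup>j\<^sub>i = D\<^sub>i x'\<^sup>j\<close>, with row index \<open>j\<close>, where \<open>x'\<^sup>j\<close> belongs to the second
  chart \<open>c'\<close> with splitting \<open>\<iota>'\<close> and is viewed as a function of the coordinates of \<open>c\<close>.\<close>

definition Q_matrix :: "nat \<Rightarrow> ('x, 'N::finite) chart \<Rightarrow> ('n::finite \<Rightarrow> 'N) \<Rightarrow>
    ('x, 'N) chart \<Rightarrow> ('n \<Rightarrow> 'N) \<Rightarrow> (real^'n \<Rightarrow> 'x) set set \<Rightarrow> real^'n^'n" where
  "Q_matrix r c \<iota> c' \<iota>' p =
     (\<chi> j i. D \<iota> i (\<lambda>q. transition c c' q $ \<iota>' j) (quotient_coords r c \<iota> p))"

section \<open>Lagrangians\<close>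

definition homogeneous_lagrangian :: "('x::topological_space, 'N::finite) chart set \<Rightarrow> nat \<Rightarrow>
    ((real^'n::finite \<Rightarrow> 'x) set \<Rightarrow> real) \<Rightarrow> bool" where
  "homogeneous_lagrangian \<A> r \<L> \<longleftrightarrow> velocity_smooth \<A> r \<L> \<and>
     (\<forall>x\<in>regular_velocities \<A> r. \<forall>a\<in>jet_group r. \<L> (jet_act \<A> r x a) = jet_det a * \<L> x)"

definition associated_lagrangian :: "('x::topological_space, 'N::finite) chart set \<Rightarrow> nat \<Rightarrow>
    ((real^'n::finite \<Rightarrow> 'x) set \<Rightarrow> real) \<Rightarrow> ('x, 'N) chart \<Rightarrow> ('n \<Rightarrow> 'N) \<Rightarrow>
    ((real^'n \<Rightarrow> 'x) set set \<Rightarrow> real) \<Rightarrow> bool" where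
  "associated_lagrangian \<A> r \<L> c \<iota> L \<longleftrightarrow>
     (\<exists>f. coord_smooth_on (quotient_indices \<iota> r)
             (quotient_coords r c \<iota> ` orbit \<A> r ` W \<A> r c \<iota>) f \<and>
          (\<forall>p\<in>orbit \<A> r ` W \<A> r c \<iota>. L p = f (quotient_coords r c \<iota> p))) \<and>
     (\<forall>x\<in>W \<A> r c \<iota>. \<L> x = det (x_matrix \<iota> (velocity_coords r c x)) * L (orbit \<A> r x))"

end

theory Submission
  imports Defs
begin

text \<open>Let \<open>x\<close> be a velocity in both domains and let \<open>y\<close> be the representative of its orbit at which
  the quotient coordinates are evaluated, \<open>y = x \<cdot> a\<close>. Write \<open>X\<close>, \<open>X'\<close> for the matrices
  of first-order coordinates \<open>x\<^sup>i\<^sub>j\<close>, \<open>x'\<^sup>i\<^sub>j\<close>. The chain rule gives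
  \<open>X(y) = X(x) A\<close> and \<open>X'(y) = X'(x) A\<close> with \<open>A\<close> the invertible Jacobian matrix of \<open>a\<close>, and, applied to the
  transition map, \<open>Q = X'(y) X(y)\<^sup>-\<^sup>1\<close>; so \<open>det X'(x) = det Q * det X(x)\<close>. Dividing
  \<open>det X(x) * L = \<L> = det X'(x) * L'\<close> by \<open>det X(x)\<close> gives the claim. The class \<open>y\<close>
  contains a smooth map because smooth maps compose.\<close>

section \<open>Partial derivatives and composition of smooth maps\<close>

lemma partial_deriv_eq:
  assumes "(f has_derivative f') (at t)"
  shows "partial_deriv j f t = f' (axis j 1)"
proof -
  have "((\<lambda>h. t + h *\<^sub>R axis j 1) has_derivative (\<lambda>h. h *\<^sub>R axis j 1)) (at 0)"
    by (auto intro!: derivative_eq_intros)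
  then have "((f \<circ> (\<lambda>h. t + h *\<^sub>R axis j 1)) has_derivative f' \<circ> (\<lambda>h. h *\<^sub>R axis j 1)) (at 0)"
    using assms by (intro diff_chain_at) auto
  then have "((\<lambda>h. f (t + h *\<^sub>R axis j 1)) has_vector_derivative f' (axis j 1)) (at 0)"
    using linear_cmul[OF has_derivative_linear[OF assms]]
    by (simp add: has_vector_derivative_def o_def)
  then show ?thesis
    unfolding partial_deriv_def by (rule vector_derivative_at)
qed

text \<open>Maps are total functions that matter only on an open set. For small parameters the line
  through \<open>t\<close> stays in \<open>U\<close>, so values elsewhere do not affect the
  derivative.\<close>

lemma partial_deriv_cong:
  assumes "open U" "t \<in> U" "\<And>x. x \<in> U \<Longrightarrow> f x = g x"
  shows "partial_deriv j f t = partial_deriv j g t"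
proof -
  have "((\<lambda>h. t + h *\<^sub>R axis j 1) \<longlongrightarrow> t + 0 *\<^sub>R axis j 1) (nhds (0::real))"
    by (intro tendsto_intros filterlim_ident)
  then have "\<forall>\<^sub>F h in nhds 0. t + h *\<^sub>R axis j 1 \<in> U"
    using assms(1,2) by (auto elim: topological_tendstoD)
  then have "\<forall>\<^sub>F h in nhds 0. f (t + h *\<^sub>R axis j 1) = g (t + h *\<^sub>R axis j 1)"
    by eventually_elim (rule assms(3))
  then show ?thesis
    unfolding partial_deriv_def by (intro vector_derivative_cong_eq) auto
qed

lemma partial_deriv_vec_nth:
  assumes "f differentiable (at t)"
  shows "partial_deriv j (\<lambda>x. f x $ k) t = partial_deriv j f t $ k"
proof -
  obtain f' where f': "(f has_derivative f') (at t)"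
    using assms by (auto simp: differentiable_def)
  show ?thesis
    using partial_deriv_eq[OF f'] partial_deriv_eq[OF bounded_linear.has_derivative[OF bounded_linear_vec_nth f']]
    by simp
qed

lemma partial_deriv_compose:
  fixes g :: "real^'n::finite \<Rightarrow> real^'k::finite" and f :: "real^'k \<Rightarrow> 'b::real_normed_vector"
  assumes "f differentiable (at (g t))" "g differentiable (at t)"
  shows "partial_deriv j (f \<circ> g) t = (\<Sum>k\<in>UNIV. partial_deriv j g t $ k *\<^sub>R partial_deriv k f (g t))"
proof -
  obtain f' where f': "(f has_derivative f') (at (g t))"
    using assms by (auto simp: differentiable_def)
  obtain g' where g': "(g has_derivative g') (at t)"
    using assms by (auto simp: differentiable_def)
  have lin: "linear f'"
    by (rule has_derivative_linear[OF f'])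
  have "partial_deriv j (f \<circ> g) t = f' (g' (axis j 1))"
    using partial_deriv_eq[OF diff_chain_at[OF g' f']] by simp
  also have "\<dots> = f' (\<Sum>k\<in>UNIV. g' (axis j 1) $ k *\<^sub>R axis k 1)"
    by (simp add: basis_expansion flip: scalar_mult_eq_scaleR)
  also have "\<dots> = (\<Sum>k\<in>UNIV. g' (axis j 1) $ k *\<^sub>R f' (axis k 1))"
    by (simp add: linear_sum[OF lin] linear_cmul[OF lin])
  finally show ?thesis
    by (simp add: partial_deriv_eq[OF f'] partial_deriv_eq[OF g'])
qed

section \<open>Differentiability of iterated partial derivatives up to a fixed order\<close>

primrec differentiable_upto ::
  "nat \<Rightarrow> (real^'n::finite) set \<Rightarrow> (real^'n \<Rightarrow> 'b::real_normed_vector) \<Rightarrow> bool" where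
  "differentiable_upto 0 U f \<longleftrightarrow> f differentiable_on U"
| "differentiable_upto (Suc n) U f \<longleftrightarrow>
     f differentiable_on U \<and> (\<forall>j. differentiable_upto n U (partial_deriv j f))"

text \<open>Truncating smoothness at order \<open>n\<close> allows induction on \<open>n\<close>
  with the function left arbitrary. The recursion differentiates \<open>f\<close> itself first, and
  \<open>foldr\<close> applies the last list entry first, so lists are split at their end.\<close>

lemma differentiable_upto_iff:
  fixes f :: "real^'n::finite \<Rightarrow> 'b::real_normed_vector"
  shows "differentiable_upto n U f \<longleftrightarrow> (\<forall>js. length js \<le> n \<longrightarrow> partial_derivs js f differentiable_on U)"
proof (induction n arbitrary: f)
  case (Suc n)
  show ?case
  proof
    assume L: "differentiable_upto (Suc n) U f"
    show "\<forall>js. length js \<le> Suc n \<longrightarrow> partial_derivs js f differentiable_on U"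
    proof (intro allI impI)
      fix js :: "'n list"
      assume "length js \<le> Suc n"
      then show "partial_derivs js f differentiable_on U"
        using L Suc.IH by (cases js rule: rev_cases) auto
    qed
  next
    assume R: "\<forall>js. length js \<le> Suc n \<longrightarrow> partial_derivs js f differentiable_on U"
    have "partial_derivs js (partial_deriv j f) differentiable_on U" if "length js \<le> n" for js j
      using R[rule_format, of "js @ [j]"] that by simp
    then show "differentiable_upto (Suc n) U f"
      using R[rule_format, of "[]"] by (auto simp: Suc.IH)
  qed
qed auto

lemma smooth_on_iff: "smooth_on U f \<longleftrightarrow> open U \<and> (\<forall>n. differentiable_upto n U f)"
  by (auto simp: smooth_on_def differentiable_upto_iff)

lemma differentiable_upto_differentiable_on: "differentiable_upto n U f \<Longrightarrow> f differentiable_on U"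
  by (cases n) auto

lemma differentiable_upto_SucD: "differentiable_upto (Suc n) U f \<Longrightarrow> differentiable_upto n U f"
  by (auto simp: differentiable_upto_iff)

lemma differentiable_upto_subset:
  "differentiable_upto n U f \<Longrightarrow> V \<subseteq> U \<Longrightarrow> differentiable_upto n V f"
  by (auto simp: differentiable_upto_iff intro: differentiable_on_subset)

text \<open>Sum, product and chain rules compute a partial derivative only at points of
  \<open>U\<close>. This lemma lets such a formula stand in for \<open>partial_deriv j f\<close> in
  the inductions on the order.\<close>

lemma differentiable_upto_cong:
  assumes "open U" "\<And>x. x \<in> U \<Longrightarrow> f x = g x" "differentiable_upto n U f"
  shows "differentiable_upto n U g"
  using assms(2,3)
proof (induction n arbitrary: f g)
  case 0
  then show ?case
    by (auto simp: differentiable_on_def intro: differentiable_transform_within[OF _ zero_less_one])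
next
  case (Suc n)
  have "g differentiable_on U"
    using Suc.prems by (auto simp: differentiable_on_def intro: differentiable_transform_within[OF _ zero_less_one])
  moreover have "differentiable_upto n U (partial_deriv j g)" for j
    using Suc.prems by (auto intro!: Suc.IH[of "partial_deriv j f" "partial_deriv j g"] partial_deriv_cong[OF assms(1)])
  ultimately show ?case by simp
qed

lemma differentiable_upto_sum:
  fixes f :: "'i \<Rightarrow> real^'n::finite \<Rightarrow> 'b::real_normed_vector"
  assumes "open U" "\<And>i. i \<in> I \<Longrightarrow> differentiable_upto n U (f i)" "finite I"
  shows "differentiable_upto n U (\<lambda>x. \<Sum>i\<in>I. f i x)"
  using assms(2)
proof (induction n arbitrary: f)
  case 0
  then show ?case using assms(3) by (auto simp: differentiable_on_def)
next
  case (Suc n)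
  have "(\<Sum>i\<in>I. partial_deriv j (f i) x) = partial_deriv j (\<lambda>x. \<Sum>i\<in>I. f i x) x"
    if "x \<in> U" for x j
  proof -
    have f': "(f i has_derivative frechet_derivative (f i) (at x)) (at x)" if "i \<in> I" for i
    proof -
      have "f i differentiable (at x)"
        using differentiable_upto_differentiable_on[OF Suc.prems[OF that]] \<open>x \<in> U\<close> assms(1)
        by (simp add: differentiable_on_eq_differentiable_at)
      then show ?thesis
        by (simp only: frechet_derivative_works)
    qed
    show ?thesis
      by (simp only: partial_deriv_eq[OF has_derivative_sum, of I f, OF f'] partial_deriv_eq[OF f'] cong: sum.cong)
  qed
  moreover have "differentiable_upto n U (\<lambda>x. \<Sum>i\<in>I. partial_deriv j (f i) x)" for j
    using Suc.prems by (intro Suc.IH) simp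
  ultimately have "differentiable_upto n U (partial_deriv j (\<lambda>x. \<Sum>i\<in>I. f i x))" for j
    by (rule differentiable_upto_cong[OF assms(1)])
  then show ?case
    using Suc.prems assms(3) by (auto simp: differentiable_on_def)
qed

lemma differentiable_upto_mult:
  fixes f g :: "real^'n::finite \<Rightarrow> real"
  assumes "open U" "differentiable_upto n U f" "differentiable_upto n U g"
  shows "differentiable_upto n U (\<lambda>x. f x * g x)"
  using assms(2,3)
proof (induction n arbitrary: f g)
  case 0
  then show ?case by (auto intro!: differentiable_on_mult)
next
  case (Suc n)
  \<comment> \<open>The two terms of the Leibniz rule are indexed by a Boolean, so that
    \<open>differentiable_upto_sum\<close> handles their sum.\<close>
  let ?h = "\<lambda>j b x. if b then f x * partial_deriv j g x else partial_deriv j f x * g x"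
  have "(\<Sum>b\<in>UNIV. ?h j b x) = partial_deriv j (\<lambda>x. f x * g x) x" if "x \<in> U" for x j
  proof -
    have "f differentiable (at x)" "g differentiable (at x)"
      using Suc.prems that assms(1) by (auto simp: differentiable_on_eq_differentiable_at)
    then obtain f' g' where f': "(f has_derivative f') (at x)" and g': "(g has_derivative g') (at x)"
      unfolding differentiable_def by blast
    show ?thesis
      using partial_deriv_eq[OF has_derivative_mult[OF f' g']]
      by (simp add: partial_deriv_eq[OF f'] partial_deriv_eq[OF g'] UNIV_bool)
  qed
  moreover have "differentiable_upto n U (?h j b)" for j b
    using Suc.prems by (cases b) (auto intro: Suc.IH simp: differentiable_upto_SucD)
  then have "differentiable_upto n U (\<lambda>x. \<Sum>b\<in>UNIV. ?h j b x)" for j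
    by (intro differentiable_upto_sum[OF assms(1)]) auto
  ultimately have "differentiable_upto n U (partial_deriv j (\<lambda>x. f x * g x))" for j
    by (rule differentiable_upto_cong[OF assms(1)])
  then show ?case
    using Suc.prems by (auto intro!: differentiable_on_mult)
qed

lemma differentiable_upto_componentwise:
  fixes f :: "real^'n::finite \<Rightarrow> real^'k::finite"
  assumes "open U"
  shows "differentiable_upto n U f \<longleftrightarrow> (\<forall>k. differentiable_upto n U (\<lambda>x. f x $ k))"
proof -
  have *: "f differentiable_on U \<longleftrightarrow> (\<forall>k. (\<lambda>x. f x $ k) differentiable_on U)"
    for f :: "real^'n \<Rightarrow> real^'k"
    unfolding differentiable_on_def
    by (subst differentiable_componentwise_within) (auto simp: Basis_vec_def inner_axis)
  show ?thesis
  proof (induction n arbitrary: f)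
    case 0
    show ?case using * by auto
  next
    case (Suc n)
    show ?case
    \<comment> \<open>Taking components commutes with \<open>partial_deriv\<close> where
      \<open>f\<close> is differentiable. If \<open>f\<close> is not differentiable on
      \<open>U\<close>, some component is not either, and both sides are false.\<close>
    proof (cases "f differentiable_on U")
      case True
      have eq: "partial_deriv j (\<lambda>x. f x $ k) x = partial_deriv j f x $ k" if "x \<in> U" for x j k
        using True that assms
        by (intro partial_deriv_vec_nth) (auto simp: differentiable_on_eq_differentiable_at)
      have "differentiable_upto n U (partial_deriv j (\<lambda>x. f x $ k)) \<longleftrightarrow>
          differentiable_upto n U (\<lambda>x. partial_deriv j f x $ k)" for j k
        by (rule iffI; erule differentiable_upto_cong[OF assms, rotated]; simp add: eq)
      then show ?thesis
        using * Suc True by auto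
    next
      case False
      then show ?thesis using * by auto
    qed
  qed
qed

lemma differentiable_on_compose_subset:
  "\<lbrakk>f differentiable_on V; g differentiable_on U; g ` U \<subseteq> V\<rbrakk> \<Longrightarrow> (f \<circ> g) differentiable_on U"
  unfolding differentiable_on_def
  by (meson differentiable_chain_within differentiable_within_subset imageI subsetD)

text \<open>Induction on the order with \<open>g\<close> fixed and \<open>f\<close> arbitrary: the
  chain rule writes a derivative of \<open>f \<circ> g\<close> as a sum of products of components of
  derivatives of \<open>g\<close> with \<open>partial_deriv k f \<circ> g\<close>, and the latter
  fall under the induction hypothesis. Real values make the product lemma applicable.\<close>

lemma differentiable_upto_compose_real:
  fixes f :: "real^'k::finite \<Rightarrow> real" and g :: "real^'n::finite \<Rightarrow> real^'k"
  assumes "open U" "open V" "g ` U \<subseteq> V" "differentiable_upto n U g" "differentiable_upto n V f"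
  shows "differentiable_upto n U (f \<circ> g)"
  using assms(4,5)
proof (induction n arbitrary: f)
  case 0
  then show ?case using assms(3) differentiable_on_compose_subset[of f V g U] by (simp add: o_def)
next
  case (Suc n)
  have d: "(f \<circ> g) differentiable_on U"
    using Suc.prems assms(3) differentiable_on_compose_subset[of f V g U] by simp
  have "(\<Sum>k\<in>UNIV. partial_deriv j g x $ k * (partial_deriv k f \<circ> g) x) = partial_deriv j (f \<circ> g) x"
    if "x \<in> U" for x j
    using Suc.prems that assms(1-3)
    by (subst partial_deriv_compose) (auto simp: differentiable_on_eq_differentiable_at)
  moreover have "differentiable_upto n U (\<lambda>x. \<Sum>k\<in>UNIV. partial_deriv j g x $ k * (partial_deriv k f \<circ> g) x)" for j
  proof (intro differentiable_upto_sum differentiable_upto_mult assms(1))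
    show "differentiable_upto n U (\<lambda>x. partial_deriv j g x $ k)" for k
      using Suc.prems differentiable_upto_componentwise[OF assms(1)] by auto
    show "differentiable_upto n U (partial_deriv k f \<circ> g)" for k
      using Suc.IH Suc.prems differentiable_upto_SucD by fastforce
  qed auto
  ultimately have "differentiable_upto n U (partial_deriv j (f \<circ> g))" for j
    by (rule differentiable_upto_cong[OF assms(1)])
  with d show ?case by (simp add: o_def)
qed

section \<open>Smooth maps: composition, restriction, the identity, Jacobian matrices\<close>

lemma smooth_on_compose:
  fixes f :: "real^'k::finite \<Rightarrow> real^'l::finite" and g :: "real^'n::finite \<Rightarrow> real^'k"
  assumes "smooth_on V f" "smooth_on U g" "g ` U \<subseteq> V"
  shows "smooth_on U (f \<circ> g)"
proof -
  have "differentiable_upto n U (\<lambda>x. (f \<circ> g) x $ i)" for n i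
    using differentiable_upto_compose_real[of U V g n "\<lambda>x. f x $ i"] assms
      differentiable_upto_componentwise[of V n f]
    by (auto simp: smooth_on_iff o_def)
  then show ?thesis
    using assms(2) differentiable_upto_componentwise[of U _ "f \<circ> g"] by (auto simp: smooth_on_iff)
qed

lemma smooth_on_subset: "smooth_on U f \<Longrightarrow> open V \<Longrightarrow> V \<subseteq> U \<Longrightarrow> smooth_on V f"
  by (auto simp: smooth_on_iff intro: differentiable_upto_subset)

lemma smooth_on_continuous_on: "smooth_on U f \<Longrightarrow> continuous_on U f"
  by (meson differentiable_imp_continuous_on differentiable_upto_differentiable_on smooth_on_iff)

lemma smooth_on_differentiable_at: "smooth_on U f \<Longrightarrow> t \<in> U \<Longrightarrow> f differentiable (at t)"
  by (metis differentiable_on_eq_differentiable_at differentiable_upto_differentiable_on smooth_on_iff)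

text \<open>Puts the jet of the identity into the jet group, so that orbits are nonempty. The first
  partial derivatives are constant, and all further ones vanish.\<close>

lemma smooth_on_id: "smooth_on UNIV (id :: real^'n::finite \<Rightarrow> real^'n)"
proof -
  have const: "differentiable_upto n UNIV (\<lambda>t::real^'n. c)" for n and c :: "real^'n"
  proof (induction n arbitrary: c)
    case (Suc n)
    have "partial_deriv j (\<lambda>t. c) = (\<lambda>t::real^'n. 0)" for j and c :: "real^'n"
      by (auto simp: partial_deriv_def)
    with Suc show ?case by simp
  qed simp
  have "partial_deriv j id = (\<lambda>t::real^'n. axis j 1)" for j
    using partial_deriv_eq[OF has_derivative_id] by auto
  then have "differentiable_upto n UNIV (id :: real^'n \<Rightarrow> real^'n)" for n
    using const by (cases n) (auto simp: id_def)
  then show ?thesis by (simp add: smooth_on_iff)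
qed

lemma jacobian_eq_partial_deriv:
  "f differentiable (at t) \<Longrightarrow> jacobian f (at t) = (\<chi> i j. partial_deriv j f t $ i)"
  by (simp add: jacobian_def matrix_def partial_deriv_eq frechet_derivative_works)

section \<open>Representatives of jets\<close>

text \<open>In a chart the composite is \<open>(\<psi> \<circ> \<gamma>) \<circ> \<alpha>\<close>, a
  composition of smooth maps between Euclidean spaces. Continuity of \<open>\<alpha>\<close> makes
  the domains open.\<close>

lemma manifold_smooth_on_compose:
  assumes \<gamma>: "manifold_smooth_on \<A> U \<gamma>" and \<alpha>: "smooth_on U' \<alpha>"
  shows "manifold_smooth_on \<A> (U' \<inter> \<alpha> -` U) (\<gamma> \<circ> \<alpha>)"
proof -
  have cont: "continuous_on U' \<alpha>" and "open U'"
    using \<alpha> by (auto simp: smooth_on_iff smooth_on_continuous_on)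
  then have op: "open (U' \<inter> \<alpha> -` S)" if "open S" for S
    using that continuous_open_preimage by blast
  have "open U"
    using \<gamma> by (simp add: manifold_smooth_on_def)
  have "smooth_on ((U' \<inter> \<alpha> -` U) \<inter> (\<gamma> \<circ> \<alpha>) -` V) (\<psi> \<circ> (\<gamma> \<circ> \<alpha>))" if "(V, \<psi>) \<in> \<A>" for V \<psi>
  proof -
    have *: "smooth_on (U \<inter> \<gamma> -` V) (\<psi> \<circ> \<gamma>)"
      using \<gamma> that by (auto simp: manifold_smooth_on_def)
    then have "smooth_on (U' \<inter> \<alpha> -` (U \<inter> \<gamma> -` V)) \<alpha>"
      by (intro smooth_on_subset[OF \<alpha>] op) (auto simp: smooth_on_def)
    from smooth_on_compose[OF * this] have "smooth_on (U' \<inter> \<alpha> -` (U \<inter> \<gamma> -` V)) (\<psi> \<circ> (\<gamma> \<circ> \<alpha>))"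
      by (auto simp: o_assoc)
    moreover have "U' \<inter> \<alpha> -` (U \<inter> \<gamma> -` V) = (U' \<inter> \<alpha> -` U) \<inter> (\<gamma> \<circ> \<alpha>) -` V"
      by auto
    ultimately show ?thesis by simp
  qed
  moreover have "continuous_on (U' \<inter> \<alpha> -` U) (\<gamma> \<circ> \<alpha>)"
  proof (rule continuous_on_compose)
    show "continuous_on (U' \<inter> \<alpha> -` U) \<alpha>"
      by (rule continuous_on_subset[OF cont]) auto
    show "continuous_on (\<alpha> ` (U' \<inter> \<alpha> -` U)) \<gamma>"
      by (rule continuous_on_subset[of U]) (use \<gamma> in \<open>auto simp: manifold_smooth_on_def\<close>)
  qed
  ultimately show ?thesis
    using op[OF \<open>open U\<close>] by (auto simp: manifold_smooth_on_def)
qed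

text \<open>\<open>rep\<close> is a choice, meaningful only on a nonempty class. Smoothness of
  \<open>\<gamma>\<close> near 0 puts \<open>\<gamma>\<close> into its own jet, so the chosen map
  satisfies the defining conditions of the class.\<close>

lemma rep_jet:
  assumes "0 \<in> U" "manifold_smooth_on \<A> U \<gamma>"
  shows "\<exists>U. 0 \<in> U \<and> manifold_smooth_on \<A> U (rep (jet \<A> r \<gamma>))"
    and "rep (jet \<A> r \<gamma>) 0 = \<gamma> 0"
    and "\<lbrakk>(V, \<psi>) \<in> \<A>; \<gamma> 0 \<in> V; length js \<le> r\<rbrakk> \<Longrightarrow>
      partial_derivs js (\<psi> \<circ> rep (jet \<A> r \<gamma>)) 0 = partial_derivs js (\<psi> \<circ> \<gamma>) 0"
proof -
  have "\<gamma> \<in> jet \<A> r \<gamma>"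
    using assms by (auto simp: jet_def)
  then have "rep (jet \<A> r \<gamma>) \<in> jet \<A> r \<gamma>"
    unfolding rep_def some_in_eq by blast
  then show "\<exists>U. 0 \<in> U \<and> manifold_smooth_on \<A> U (rep (jet \<A> r \<gamma>))"
    and "rep (jet \<A> r \<gamma>) 0 = \<gamma> 0"
    and "\<lbrakk>(V, \<psi>) \<in> \<A>; \<gamma> 0 \<in> V; length js \<le> r\<rbrakk> \<Longrightarrow>
      partial_derivs js (\<psi> \<circ> rep (jet \<A> r \<gamma>)) 0 = partial_derivs js (\<psi> \<circ> \<gamma>) 0"
    unfolding jet_def by blast+
qed

lemma manifold_smooth_on_std_atlas: "manifold_smooth_on std_atlas U \<alpha> \<longleftrightarrow> smooth_on U \<alpha>"
proof
  assume "smooth_on U \<alpha>"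
  then show "manifold_smooth_on std_atlas U \<alpha>"
    using smooth_on_continuous_on
    by (auto simp: manifold_smooth_on_def std_atlas_def smooth_on_iff)
qed (auto simp: manifold_smooth_on_def std_atlas_def)

lemma manifold_smooth_on_chart_differentiable:
  assumes "manifold_smooth_on \<A> U \<gamma>" "(V, \<psi>) \<in> \<A>" "t \<in> U" "\<gamma> t \<in> V"
  shows "(\<psi> \<circ> \<gamma>) differentiable (at t)"
  using assms smooth_on_differentiable_at[of "U \<inter> \<gamma> -` V" "\<psi> \<circ> \<gamma>" t]
  by (auto simp: manifold_smooth_on_def)

text \<open>Differentiating \<open>\<beta> \<circ> \<alpha> = id\<close> near 0 gives the derivative
  of \<open>\<alpha>\<close> a left inverse, so it is injective.\<close>

lemma local_diffeo_det_jacobian: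
  assumes "local_diffeo_fixing_0 \<alpha>"
  shows "det (jacobian \<alpha> (at 0)) \<noteq> 0"
proof -
  obtain U U' \<beta> where U: "0 \<in> U" and \<alpha>: "smooth_on U \<alpha>" and \<beta>: "smooth_on U' \<beta>"
    and hom: "homeomorphism U U' \<alpha> \<beta>"
    using assms by (auto simp: local_diffeo_fixing_0_def)
  have "\<alpha> 0 \<in> U'"
    using hom U by (auto simp: homeomorphism_def)
  then obtain \<beta>' where \<beta>': "(\<beta> has_derivative \<beta>') (at (\<alpha> 0))"
    using smooth_on_differentiable_at[OF \<beta>] by (auto simp: differentiable_def)
  let ?\<alpha>' = "frechet_derivative \<alpha> (at 0)"
  have \<alpha>': "(\<alpha> has_derivative ?\<alpha>') (at 0)"
    using smooth_on_differentiable_at[OF \<alpha> U] by (simp add: frechet_derivative_works)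
  have "open U"
    using \<alpha> by (simp add: smooth_on_def)
  have "((\<beta> \<circ> \<alpha>) has_derivative id) (at 0)"
    by (rule has_derivative_transform_within_open[OF has_derivative_id \<open>open U\<close> U])
      (use hom in \<open>auto simp: homeomorphism_def\<close>)
  then have "\<beta>' \<circ> ?\<alpha>' = id"
    using has_derivative_unique diff_chain_at[OF \<alpha>' \<beta>'] by blast
  then have "inj ?\<alpha>'"
    by (metis inj_on_id inj_on_imageI2)
  then show ?thesis
    using det_nz_iff_inj[OF has_derivative_linear[OF \<alpha>']] by (simp add: jacobian_def)
qed

section \<open>First-order coordinates\<close>

text \<open>A multiset of size at most one has a single enumeration, so the choice in
  \<open>enum_mset\<close> is determined for coordinates of order 0 and 1.\<close>

lemma enum_mset_empty [simp]: "enum_mset {#} = []"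
  by (simp add: enum_mset_def)

lemma enum_mset_single [simp]: "enum_mset {#j#} = [j]"
  by (simp add: enum_mset_def)

lemma velocity_coords_empty: "velocity_coords r c x (A, {#}) = snd c (rep x 0) $ A"
  by (simp add: velocity_coords_def velocity_indices_def)

text \<open>For \<open>r = 0\<close> the index lies outside \<open>velocity_indices r\<close> and
  the coordinate has the default value 0.\<close>

lemma velocity_coords_single:
  "r \<ge> 1 \<Longrightarrow> velocity_coords r c x (A, {#j#}) = partial_deriv j (snd c \<circ> rep x) 0 $ A"
  by (simp add: velocity_coords_def velocity_indices_def)

text \<open>The coordinates of the new velocity are read from a representative that may differ from
  \<open>rep x \<circ> rep a\<close>. By \<open>rep_jet\<close> both have the same first
  derivatives, as \<open>r \<ge> 1\<close>, and the chain rule applies to the composite.\<close>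

lemma x_matrix_jet_act:
  assumes "r \<ge> 1" "(V, \<psi>) \<in> \<A>"
    and \<gamma>: "0 \<in> U" "manifold_smooth_on \<A> U (rep x)" "rep x 0 \<in> V"
    and \<alpha>: "0 \<in> U'" "smooth_on U' (rep a)" "rep a 0 = 0"
  shows "x_matrix \<iota> (velocity_coords r (V, \<psi>) (jet_act \<A> r x a)) =
    x_matrix \<iota> (velocity_coords r (V, \<psi>) x) ** jacobian (rep a) (at 0)"
proof -
  have 1: "0 \<in> U' \<inter> rep a -` U" "manifold_smooth_on \<A> (U' \<inter> rep a -` U) (rep x \<circ> rep a)"
    using \<gamma> \<alpha> manifold_smooth_on_compose by auto
  have da: "rep a differentiable (at 0)"
    using smooth_on_differentiable_at \<alpha> by blast
  have dx: "(\<psi> \<circ> rep x) differentiable (at (rep a 0))"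
    using manifold_smooth_on_chart_differentiable[OF \<gamma>(2) assms(2) \<gamma>(1,3)] \<alpha>(3) by simp
  have "partial_deriv j (\<psi> \<circ> rep (jet_act \<A> r x a)) 0 =
      (\<Sum>k\<in>UNIV. partial_deriv j (rep a) 0 $ k *\<^sub>R partial_deriv k (\<psi> \<circ> rep x) 0)" for j
    using rep_jet(3)[OF 1 assms(2), of "[j]" r] assms(1) \<gamma>(3) \<alpha>(3)
      partial_deriv_compose[OF dx da, of j]
    by (simp add: jet_act_def o_assoc)
  then show ?thesis
    using assms(1) da
    by (simp add: vec_eq_iff x_matrix_def matrix_matrix_mult_def velocity_coords_single
        jacobian_eq_partial_deriv mult.commute)
qed

section \<open>Coordinates of order 0 and 1 on the quotient, and the matrix Q\<close>

lemma quotient_coords_empty: "quotient_coords r c \<iota> p (A, {#}) = snd c (rep (rep p) 0) $ A"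
  by (simp add: quotient_coords_def quotient_indices_def velocity_coords_empty)

lemma formal_deriv_coordinate:
  fixes u :: "('N::finite, 'n::finite) jet_index \<Rightarrow> real"
  shows "formal_deriv 0 j (\<lambda>u. u (\<sigma>, {#})) u = u (\<sigma>, {#j#})"
proof -
  have "(velocity_indices 0 :: ('N, 'n) jet_index set) = range (\<lambda>A. (A, {#}))"
    by (auto simp: velocity_indices_def)
  then have "formal_deriv 0 j (\<lambda>u. u (\<sigma>, {#})) u =
      (\<Sum>A\<in>UNIV. u (A, {#j#}) * coord_deriv (A, {#}) (\<lambda>u. u (\<sigma>, {#})) u)"
    by (simp add: formal_deriv_def sum.reindex inj_on_def)
  \<comment> \<open>The partial derivatives of a coordinate function are Kronecker deltas.\<close>
  also have "\<dots> = (\<Sum>A\<in>UNIV. if A = \<sigma> then u (A, {#j#}) else 0)"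
    by (intro sum.cong) (auto simp: coord_deriv_def)
  finally show ?thesis by simp
qed

text \<open>One step of the recursion for \<open>y_fun\<close>. For \<open>\<sigma>\<close> in
  \<open>range \<iota>\<close> the index is not a quotient index and the value would be the default
  0.\<close>

lemma quotient_coords_single:
  assumes "r \<ge> 1" "\<sigma> \<notin> range \<iota>"
  shows "quotient_coords r c \<iota> p (\<sigma>, {#i#}) =
    (\<Sum>j\<in>UNIV. matrix_inv (x_matrix \<iota> (velocity_coords r c (rep p))) $ j $ i *
      velocity_coords r c (rep p) (\<sigma>, {#j#}))"
  using assms by (simp add: quotient_coords_def quotient_indices_def formal_deriv_coordinate)

text \<open>The chain rule for the transition map gives the right side as a sum over all coordinates
  \<open>A\<close>. On the left, the matrix of the \<open>x^i_k\<close> cancels the inverse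
  contained in \<open>y^\<sigma>_i\<close> and leaves \<open>x^\<sigma>_k\<close>; the two parts of
  \<open>D\<close> then supply the terms with \<open>A\<close> inside and outside
  \<open>range \<iota>\<close>.\<close>

lemma Q_matrix_mult_x_matrix:
  fixes \<A> :: "('x::topological_space, 'N::finite) chart set"
    and \<iota> \<iota>' :: "'n::finite \<Rightarrow> 'N" and p :: "(real^'n \<Rightarrow> 'x) set set"
  assumes "r \<ge> 1" and c: "(V, \<psi>) \<in> \<A>" "(V', \<psi>') \<in> \<A>"
    and chart: "is_chart (V, \<psi>)" "is_chart (V', \<psi>')" "compatible (V, \<psi>) (V', \<psi>')"
    and \<delta>: "0 \<in> U" "manifold_smooth_on \<A> U (rep (rep p))" "rep (rep p) 0 \<in> V \<inter> V'"
    and inj: "inj \<iota>"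
    and X: "det (x_matrix \<iota> (velocity_coords r (V, \<psi>) (rep p))) \<noteq> 0"
  shows "Q_matrix r (V, \<psi>) \<iota> (V', \<psi>') \<iota>' p ** x_matrix \<iota> (velocity_coords r (V, \<psi>) (rep p)) =
    x_matrix \<iota>' (velocity_coords r (V', \<psi>') (rep p))"
proof -
  \<comment> \<open>\<open>p\<close> is an orbit, \<open>rep p\<close> a velocity in it and
    \<open>\<delta>\<close> a map in that velocity. All coordinates are read from
    \<open>\<delta>\<close>, and \<open>q\<close> is its base point in the first chart.\<close>
  define \<delta> where "\<delta> = rep (rep p)"
  define u where "u = velocity_coords r (V, \<psi>) (rep p)"
  define \<tau> where "\<tau> = transition (V, \<psi>) (V', \<psi>')"
  define q where "q = \<psi> (\<delta> 0)"
  note \<delta> = \<delta>[folded \<delta>_def]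
  let ?X = "x_matrix \<iota> u" and ?Z = "matrix_inv (x_matrix \<iota> u)"
  have "smooth_on (\<psi> ` (V \<inter> V')) \<tau>"
    using chart(3) by (simp add: compatible_def \<tau>_def)
  then have d\<tau>: "\<tau> differentiable (at q)"
    using \<delta>(3) smooth_on_differentiable_at by (auto simp: q_def)
  have d\<delta>: "(\<psi> \<circ> \<delta>) differentiable (at 0)"
    using manifold_smooth_on_chart_differentiable \<delta> c(1) by blast
  \<comment> \<open>The maps \<open>\<psi>' \<circ> \<delta>\<close> and
    \<open>\<tau> \<circ> (\<psi> \<circ> \<delta>)\<close> agree on this neighbourhood of 0, which
    suffices for equal partial derivatives at 0.\<close>
  have "open (U \<inter> \<delta> -` (V \<inter> V'))"
    using chart(1,2) \<delta>(2) by (intro continuous_open_preimage) (auto simp: is_chart_def manifold_smooth_on_def)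
  moreover have "\<tau> (\<psi> y) = \<psi>' y" if "y \<in> V" for y
    using chart(1) that by (simp add: \<tau>_def transition_def is_chart_def homeomorphism_def)
  ultimately have "partial_deriv k (\<psi>' \<circ> \<delta>) 0 = partial_deriv k (\<tau> \<circ> (\<psi> \<circ> \<delta>)) 0" for k
    using \<delta> by (intro partial_deriv_cong[of "U \<inter> \<delta> -` (V \<inter> V')"]) auto
  then have X': "partial_deriv k (\<psi>' \<circ> \<delta>) 0 $ B = (\<Sum>A\<in>UNIV. u (A, {#k#}) * partial_deriv A \<tau> q $ B)" for k B
    using partial_deriv_compose[of \<tau> "\<psi> \<circ> \<delta>" 0 k] d\<tau> d\<delta> assms(1)
    by (simp add: q_def u_def velocity_coords_single \<delta>_def)
  \<comment> \<open>\<open>D\<close> differentiates at the point formed by the quotient coordinates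
    of order 0, which is \<open>q\<close>.\<close>
  have w: "(\<chi> A. quotient_coords r (V, \<psi>) \<iota> p (A, {#})) = q"
    by (simp add: quotient_coords_empty q_def \<delta>_def vec_eq_iff)
  have Q: "Q_matrix r (V, \<psi>) \<iota> (V', \<psi>') \<iota>' p $ l $ i =
      partial_deriv (\<iota> i) \<tau> q $ \<iota>' l +
      (\<Sum>\<sigma>\<in>- range \<iota>. (\<Sum>j\<in>UNIV. ?Z $ j $ i * u (\<sigma>, {#j#})) * partial_deriv \<sigma> \<tau> q $ \<iota>' l)" for l i
    using assms(1) d\<tau>
    by (simp add: Q_matrix_def D_def w Let_def quotient_coords_single u_def
        partial_deriv_vec_nth flip: \<tau>_def)
  have ZX: "(\<Sum>i\<in>UNIV. ?Z $ j $ i * ?X $ i $ k) = (if j = k then 1 else 0)" for j k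
  proof -
    \<comment> \<open>\<open>matrix_inv\<close> chooses a two-sided inverse; the nonzero determinant
      ensures that one exists.\<close>
    have "\<exists>B. ?X ** B = mat 1 \<and> B ** ?X = mat 1"
      using X by (simp add: u_def flip: invertible_det_nz invertible_def)
    then have "?Z ** ?X = mat 1"
      unfolding matrix_inv_def by (rule someI2_ex) simp
    then show ?thesis
      by (simp add: vec_eq_iff matrix_matrix_mult_def mat_def)
  qed
  have "(\<Sum>i\<in>UNIV. Q_matrix r (V, \<psi>) \<iota> (V', \<psi>') \<iota>' p $ l $ i * ?X $ i $ k) =
      partial_deriv k (\<psi>' \<circ> \<delta>) 0 $ \<iota>' l" for l k
  proof -
    let ?d = "\<lambda>A. partial_deriv A \<tau> q $ \<iota>' l"
    \<comment> \<open>The sum over \<open>i\<close> is moved innermost, where \<open>ZX\<close>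
      collapses it to a Kronecker delta that selects \<open>j = k\<close>.\<close>
    have "(\<Sum>i\<in>UNIV. (\<Sum>\<sigma>\<in>- range \<iota>. (\<Sum>j\<in>UNIV. ?Z $ j $ i * u (\<sigma>, {#j#})) * ?d \<sigma>) * ?X $ i $ k)
        = (\<Sum>i\<in>UNIV. \<Sum>\<sigma>\<in>- range \<iota>. \<Sum>j\<in>UNIV. ?d \<sigma> * u (\<sigma>, {#j#}) * (?Z $ j $ i * ?X $ i $ k))"
      by (simp add: sum_distrib_left sum_distrib_right mult_ac)
    also have "\<dots> = (\<Sum>\<sigma>\<in>- range \<iota>. \<Sum>i\<in>UNIV. \<Sum>j\<in>UNIV. ?d \<sigma> * u (\<sigma>, {#j#}) * (?Z $ j $ i * ?X $ i $ k))"
      by (rule sum.swap)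
    also have "\<dots> = (\<Sum>\<sigma>\<in>- range \<iota>. \<Sum>j\<in>UNIV. \<Sum>i\<in>UNIV. ?d \<sigma> * u (\<sigma>, {#j#}) * (?Z $ j $ i * ?X $ i $ k))"
      by (intro sum.cong refl sum.swap)
    also have "\<dots> = (\<Sum>\<sigma>\<in>- range \<iota>. u (\<sigma>, {#k#}) * ?d \<sigma>)"
      by (simp add: ZX if_distrib cong: if_cong flip: sum_distrib_left) (simp add: mult.commute)
    finally have "(\<Sum>i\<in>UNIV. (\<Sum>\<sigma>\<in>- range \<iota>. (\<Sum>j\<in>UNIV. ?Z $ j $ i * u (\<sigma>, {#j#})) * ?d \<sigma>) * ?X $ i $ k)
        = (\<Sum>\<sigma>\<in>- range \<iota>. u (\<sigma>, {#k#}) * ?d \<sigma>)" .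
    moreover have "?X $ i $ k = u (\<iota> i, {#k#})" for i
      by (simp add: x_matrix_def)
    ultimately have "(\<Sum>i\<in>UNIV. Q_matrix r (V, \<psi>) \<iota> (V', \<psi>') \<iota>' p $ l $ i * ?X $ i $ k) =
        (\<Sum>i\<in>UNIV. u (\<iota> i, {#k#}) * ?d (\<iota> i)) + (\<Sum>\<sigma>\<in>- range \<iota>. u (\<sigma>, {#k#}) * ?d \<sigma>)"
      by (simp add: Q distrib_right sum.distrib) (simp add: mult.commute)
    \<comment> \<open>Injectivity of \<open>\<iota>\<close> turns the sum over \<open>i\<close> into
      one over \<open>range \<iota>\<close>, which together with its complement exhausts the
      coordinates.\<close>
    also have "(\<Sum>i\<in>UNIV. u (\<iota> i, {#k#}) * ?d (\<iota> i)) = (\<Sum>A\<in>range \<iota>. u (A, {#k#}) * ?d A)"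
      using inj by (simp add: sum.reindex)
    also have "\<dots> + (\<Sum>\<sigma>\<in>- range \<iota>. u (\<sigma>, {#k#}) * ?d \<sigma>) = (\<Sum>A\<in>UNIV. u (A, {#k#}) * ?d A)"
      by (subst sum.union_disjoint[symmetric]) auto
    finally show ?thesis by (simp add: X')
  qed
  then show ?thesis
    using assms(1)
    by (simp add: vec_eq_iff matrix_matrix_mult_def x_matrix_def[of \<iota>'] velocity_coords_single
        flip: \<delta>_def u_def)
qed

theorem proposition3p6:
  fixes \<A> :: "('x::{t2_space, second_countable_topology}, 'N::finite) chart set"
    and r :: nat
    and \<L> :: "(real^'n::finite \<Rightarrow> 'x) set \<Rightarrow> real"
    and V V' :: "'x set" and \<psi> \<psi>' :: "'x \<Rightarrow> real^'N"
    and \<iota> \<iota>' :: "'n \<Rightarrow> 'N"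
    and L L' :: "(real^'n \<Rightarrow> 'x) set set \<Rightarrow> real"
  assumes "smooth_structure \<A>"
    and "r \<ge> 1"
    and "homogeneous_lagrangian \<A> r \<L>"
    and "(V, \<psi>) \<in> \<A>" and "(V', \<psi>') \<in> \<A>" and "V \<inter> V' \<noteq> {}"
    and "inj \<iota>" and "inj \<iota>'"
    and "associated_lagrangian \<A> r \<L> (V, \<psi>) \<iota> L"
    and "associated_lagrangian \<A> r \<L> (V', \<psi>') \<iota>' L'"
  shows "\<forall>p \<in> orbit \<A> r ` (W \<A> r (V, \<psi>) \<iota> \<inter> W \<A> r (V', \<psi>') \<iota>').
    L p = det (Q_matrix r (V, \<psi>) \<iota> (V', \<psi>') \<iota>' p) * L' p"
proof
  fix p
  assume "p \<in> orbit \<A> r ` (W \<A> r (V, \<psi>) \<iota> \<inter> W \<A> r (V', \<psi>') \<iota>')"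
  then obtain x where p: "p = orbit \<A> r x" and x: "x \<in> W \<A> r (V, \<psi>) \<iota>" "x \<in> W \<A> r (V', \<psi>') \<iota>'"
    by blast
  let ?X = "\<lambda>y. x_matrix \<iota> (velocity_coords r (V, \<psi>) y)"
  let ?X' = "\<lambda>y. x_matrix \<iota>' (velocity_coords r (V', \<psi>') y)"
  obtain \<gamma> U\<^sub>0 where \<gamma>: "x = jet \<A> r \<gamma>" "0 \<in> U\<^sub>0" "manifold_smooth_on \<A> U\<^sub>0 \<gamma>"
    using x(1) by (auto simp: W_def velocities_over_def regular_velocities_def immersion_on_def)
  obtain U where U: "0 \<in> U" "manifold_smooth_on \<A> U (rep x)"
    using rep_jet(1)[OF \<gamma>(2,3)] \<gamma>(1) by blast
  have V: "rep x 0 \<in> V" "rep x 0 \<in> V'" and det: "det (?X x) \<noteq> 0"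
    using x by (auto simp: W_def velocities_over_def)
  \<comment> \<open>The identity jet makes the orbit nonempty, so the chosen \<open>rep p\<close>
    does lie in \<open>p\<close> and has the form \<open>x \<cdot> a\<close>.\<close>
  have "local_diffeo_fixing_0 (id :: real^'n \<Rightarrow> real^'n)"
    using smooth_on_id homeomorphism_ident by (auto simp: local_diffeo_fixing_0_def id_def)
  then have "p \<noteq> {}"
    by (auto simp: p orbit_def jet_group_def)
  then have "rep p \<in> p"
    by (auto simp: rep_def some_in_eq)
  then obtain \<alpha> a where \<alpha>: "local_diffeo_fixing_0 \<alpha>" and a: "a = jet std_atlas r \<alpha>"
    and y: "rep p = jet_act \<A> r x a"
    by (auto simp: p orbit_def jet_group_def)
  obtain U' where U': "0 \<in> U'" "manifold_smooth_on std_atlas U' \<alpha>"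
    using \<alpha> by (auto simp: local_diffeo_fixing_0_def manifold_smooth_on_std_atlas)
  obtain U'' where U'': "0 \<in> U''" "smooth_on U'' (rep a)"
    using rep_jet(1)[OF U'] by (auto simp: a manifold_smooth_on_std_atlas)
  have a0: "rep a 0 = 0"
    using rep_jet(2)[OF U'] \<alpha> by (simp add: a local_diffeo_fixing_0_def)
  \<comment> \<open>The action uses \<open>rep a\<close>, while an invertible Jacobian matrix is
    known for \<open>\<alpha>\<close>. Their first derivatives at 0 agree because
    \<open>r \<ge> 1\<close>.\<close>
  have "partial_deriv j (rep a) 0 = partial_deriv j \<alpha> 0" for j
    using rep_jet(3)[OF U', of UNIV id "[j]" r] \<open>r \<ge> 1\<close> by (simp add: a std_atlas_def)
  then have "jacobian (rep a) (at 0) = jacobian \<alpha> (at 0)"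
    using smooth_on_differentiable_at U' U''
    by (metis (no_types, lifting) ext jacobian_eq_partial_deriv manifold_smooth_on_std_atlas)
  then have deta: "det (jacobian (rep a) (at 0)) \<noteq> 0"
    using local_diffeo_det_jacobian[OF \<alpha>] by simp
  have Xy: "det (?X (rep p)) = det (?X x) * det (jacobian (rep a) (at 0))"
    and X'y: "det (?X' (rep p)) = det (?X' x) * det (jacobian (rep a) (at 0))"
    unfolding y
    using x_matrix_jet_act[OF assms(2,4) U V(1) U'' a0] x_matrix_jet_act[OF assms(2,5) U V(2) U'' a0]
    by (simp_all add: det_mul)
  \<comment> \<open>With the composite smooth near 0, \<open>rep_jet\<close> shows that
    \<open>rep (rep p)\<close> is smooth near 0 and has the same base point as
    \<open>rep x\<close>.\<close>
  have comp: "0 \<in> U'' \<inter> rep a -` U" "manifold_smooth_on \<A> (U'' \<inter> rep a -` U) (rep x \<circ> rep a)"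
    using U U'' a0 manifold_smooth_on_compose by auto
  obtain U\<^sub>1 where U\<^sub>1: "0 \<in> U\<^sub>1" "manifold_smooth_on \<A> U\<^sub>1 (rep (rep p))"
    using rep_jet(1)[OF comp] by (auto simp: y jet_act_def)
  have "rep (rep p) 0 \<in> V \<inter> V'"
    using rep_jet(2)[OF comp] V a0 by (simp add: y jet_act_def)
  moreover have "is_chart (V, \<psi>)" "is_chart (V', \<psi>')" "compatible (V, \<psi>) (V', \<psi>')"
    using assms(1,4,5) unfolding smooth_structure_def by blast+
  moreover have "det (?X (rep p)) \<noteq> 0"
    using Xy det deta by simp
  ultimately have "Q_matrix r (V, \<psi>) \<iota> (V', \<psi>') \<iota>' p ** ?X (rep p) = ?X' (rep p)"
    using Q_matrix_mult_x_matrix[OF assms(2,4,5)] U\<^sub>1 assms(7) by blast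
  then have "det (Q_matrix r (V, \<psi>) \<iota> (V', \<psi>') \<iota>' p) * det (?X (rep p)) = det (?X' (rep p))"
    by (metis det_mul)
  \<comment> \<open>The matrix identity holds at \<open>rep p\<close>; cancelling the common factor
    \<open>det (jacobian (rep a) (at 0))\<close> carries its determinant over to
    \<open>x\<close>.\<close>
  then have Q: "det (?X' x) = det (Q_matrix r (V, \<psi>) \<iota> (V', \<psi>') \<iota>' p) * det (?X x)"
    using deta by (simp add: Xy X'y)
  \<comment> \<open>Both sides equal \<open>\<L> x\<close>, since \<open>x\<close> lies in both
    domains and \<open>p\<close> is its orbit.\<close>
  have "det (?X x) * L p = det (?X' x) * L' p"
    using assms(9,10) x unfolding associated_lagrangian_def p by metis
  with Q det show "L p = det (Q_matrix r (V, \<psi>) \<iota> (V', \<psi>') \<iota>' p) * L' p"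
    by simp
qed

end
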